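(* Let $G$ be a finite simple graph whose Seidel matrix has all but at most two eigenvalues (counted with multiplicity) in the interval $[-1,1]$. Then $G$ is switching equivalent to a graph in $\mathcal{F}$, where $\mathcal{F}$ is the class of graphs $H$ such that $H$ or its complement is isomorphic to $K_m+\ell K_1$ (a clique on $m$ vertices plus $\ell$ isolated vertices) for some $m\geq1$, $\ell\geq 0$.
   Context: The Seidel matrix of a graph $G$ with adjacency matrix $A_G$ is $S=J-I-2A_G$ (entries $-1$ for adjacent pairs, $+1$ for nonadjacent distinct pairs, $0$ on the diagonal); $J$ is the all-ones matrix. Switching $G$ with respect to a vertex subset $X$ replaces, for every pair $u\in X$, $v\notin X$, adjacency by nonadjacency and vice versa (equivalently, multiplies the rows and columns of $S$ indexed by $X$ by $-1$). Two graphs are switching equivalent if one can be switched into a graph isomorphic to the other. *)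

theory Defs
  imports
    "Jordan_Normal_Form.Char_Poly"
    "Graph_Theory.Pair_Digraph"
    "Graph_Theory.Digraph_Isomorphism"
begin

text \<open>
  Finite simple graphs are the finite symmetric loop-free digraphs without parallel arcs,
  i.e. the instances of \<^locale>\<open>pair_graph\<close>: an edge \<open>uv\<close> is the pair of arcs
  \<open>(u, v)\<close>, \<open>(v, u)\<close>.
\<close>

definition graph_complement :: "'a pair_pre_digraph \<Rightarrow> 'a pair_pre_digraph" where
  "graph_complement G =
     \<lparr> pverts = pverts G,
       parcs = {(u, v) \<in> pverts G \<times> pverts G. u \<noteq> v \<and> (u, v) \<notin> parcs G} \<rparr>"

definition switch :: "'a pair_pre_digraph \<Rightarrow> 'a set \<Rightarrow> 'a pair_pre_digraph" where
  "switch G X =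
     \<lparr> pverts = pverts G,
       parcs = {(u, v) \<in> pverts G \<times> pverts G.
                  if (u \<in> X) = (v \<in> X) then (u, v) \<in> parcs G else (u, v) \<notin> parcs G} \<rparr>"

definition switching_equivalent :: "'a pair_pre_digraph \<Rightarrow> 'b pair_pre_digraph \<Rightarrow> bool" where
  "switching_equivalent G H \<longleftrightarrow>
     (\<exists>X \<subseteq> pverts G. digraph_iso (with_proj (switch G X)) (with_proj H))"

text \<open>\<open>K\<^sub>m + l K\<^sub>1\<close>: the clique is on \<open>{..<m}\<close>, the isolated vertices are \<open>m, \<dots>, m + l - 1\<close>.\<close>

definition clique_plus_isolated :: "nat \<Rightarrow> nat \<Rightarrow> nat pair_pre_digraph" where
  "clique_plus_isolated m l =
     \<lparr> pverts = {..<m + l}, parcs = {(u, v). u < m \<and> v < m \<and> u \<noteq> v} \<rparr>"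

definition family_F :: "'a pair_pre_digraph set" where
  "family_F = {H. pair_graph H \<and>
     (\<exists>m l. m \<ge> 1 \<and>
        (digraph_iso (with_proj H) (with_proj (clique_plus_isolated m l)) \<or>
         digraph_iso (with_proj (graph_complement H)) (with_proj (clique_plus_isolated m l))))}"

text \<open>
  Matrices of a graph are taken with respect to a list \<open>vs\<close> enumerating its vertices without
  repetition: row and column \<open>i\<close> belong to the vertex \<open>vs ! i\<close>.
\<close>

definition adjacency_matrix :: "'a pair_pre_digraph \<Rightarrow> 'a list \<Rightarrow> real mat" where
  "adjacency_matrix G vs =
     mat (length vs) (length vs) (\<lambda>(i, j). if (vs ! i, vs ! j) \<in> parcs G then 1 else 0)"

definition all_ones_matrix :: "nat \<Rightarrow> real mat" where
  "all_ones_matrix n = mat n n (\<lambda>_. 1)"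

definition seidel_matrix :: "'a pair_pre_digraph \<Rightarrow> 'a list \<Rightarrow> real mat" where
  "seidel_matrix G vs =
     all_ones_matrix (length vs) - 1\<^sub>m (length vs) - 2 \<cdot>\<^sub>m adjacency_matrix G vs"

text \<open>
  Eigenvalues with algebraic multiplicity. A Seidel matrix is real symmetric, so its
  characteristic polynomial splits over the reals and no eigenvalue is lost by taking real roots.
\<close>

definition eigenvalues_mset :: "real mat \<Rightarrow> real multiset" where
  "eigenvalues_mset A = proots (char_poly A)"

lemma seidel_matrix_index:
  assumes "pair_graph G" and "distinct vs" and "i < length vs" and "j < length vs"
  shows "seidel_matrix G vs $$ (i, j) =
    (if i = j then 0 else if (vs ! i, vs ! j) \<in> parcs G then -1 else 1)"
proof -
  interpret pair_graph G by fact
  have "(v, v) \<notin> parcs G" for v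
    using pair_no_loops[of "(v, v)"] by auto
  then show ?thesis
    using assms(2-4)
    by (auto simp: seidel_matrix_def adjacency_matrix_def all_ones_matrix_def)
qed

end

theory Submission
  imports Defs "Jordan_Normal_Form.Schur_Decomposition"
begin

text \<open>
  Suppose that \<open>a, b, c\<close> are three of five vertices and that the corresponding rows of the
  5 by 5 Seidel matrix have pairwise inner products \<open>\<plusminus>1\<close> (the only alternative is \<open>\<plusminus>3\<close>).
  These rows have squared length 4, so their Gram matrix exceeds the identity, and the full Seidel
  matrix \<open>S\<close> strictly expands every nonzero vector supported on \<open>{a, b, c}\<close>. By the spectral theorem
  \<open>S\<close> does not expand on a subspace of codimension the number of eigenvalues outside \<open>[-1, 1]\<close>;
  if there are at most two of these, the subspace meets the span of \<open>a, b, c\<close>. Hence no such five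
  vertices exist. This property is invariant under switching. Switching a vertex \<open>v\<close> to be isolated,
  it says that the rest of the graph has no induced \<open>C\<^sub>4\<close>, \<open>2K\<^sub>2\<close>, \<open>P\<^sub>4\<close>, \<open>P\<^sub>3 + K\<^sub>1\<close> or paw, and
  such graphs are \<open>K\<^sub>m + lK\<^sub>1\<close> or complements of these; in the second case \<open>v\<close> is switched once more
  to become dominating.
\<close>

section \<open>Real symmetric matrices\<close>

text \<open>Over the complex numbers there is a root \<open>z\<close> with an eigenvector
  \<open>v\<close>. As the matrix is real and symmetric, moving it across the product of
  \<open>v\<close> with its conjugate turns \<open>z\<close> into \<open>cnj z\<close>, so
  \<open>z\<close> is real.\<close>

lemma symmetric_mat_has_real_eigenvalue:
  fixes A :: "real mat"
  assumes A: "A \<in> carrier_mat n n" and sym: "A\<^sup>T = A" and n: "n > 0"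
  shows "\<exists>e. eigenvalue A e"
proof -
  let ?c = "complex_of_real"
  let ?B = "map_mat ?c A"
  have B: "?B \<in> carrier_mat n n" and symB: "?B\<^sup>T = ?B"
    using A sym by (auto simp: map_mat_transpose)
  obtain as where as: "char_poly ?B = (\<Prod>a\<leftarrow>as. [:- a, 1:])" "length as = n"
    using char_poly_factorized[OF B] by blast
  then obtain z where z: "poly (char_poly ?B) z = 0"
    using n by (cases as) auto
  then obtain v where v: "v \<in> carrier_vec n" "v \<noteq> 0\<^sub>v n" and Bv: "?B *\<^sub>v v = z \<cdot>\<^sub>v v"
    using B unfolding eigenvalue_root_char_poly[OF B, symmetric] eigenvalue_def eigenvector_def
    by auto
  have conj: "?B *\<^sub>v conjugate v = conjugate (?B *\<^sub>v v)"
    using A v by (intro eq_vecI) (auto simp: scalar_prod_def)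
  have "z * (v \<bullet>c v) = (?B *\<^sub>v v) \<bullet>c v"
    using v Bv by simp
  also have "\<dots> = v \<bullet> (?B *\<^sub>v conjugate v)"
    using transpose_vec_mult_scalar[OF B, of "conjugate v" v] v symB by simp
  also have "\<dots> = cnj z * (v \<bullet>c v)"
    unfolding conj Bv using v by (simp add: conjugate_smult_vec)
  finally have "z = cnj z"
    using v conjugate_square_eq_0_vec[OF v(1)] by simp
  then have "z = ?c (Re z)"
    by (simp add: complex_eq_iff)
  with z have "poly (map_poly ?c (char_poly A)) (?c (Re z)) = 0"
    by (simp add: of_real_hom.char_poly_hom[OF A])
  then have "poly (char_poly A) (Re z) = 0"
    by simp
  then show ?thesis
    using eigenvalue_root_char_poly[OF A] by blast
qed

text \<open>Gram-Schmidt keeps the first vector of a basis that starts with \<open>v\<close>;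
  dividing all vectors by their lengths gives the columns of \<open>W\<close>. The factor
  \<open>t\<close> comes from this normalisation.\<close>

lemma orthonormal_mat_completion:
  fixes v :: "real vec"
  assumes v: "v \<in> carrier_vec n" "v \<noteq> 0\<^sub>v n"
  shows "\<exists>W t. W \<in> carrier_mat n n \<and> W\<^sup>T * W = 1\<^sub>m n \<and> col W 0 = t \<cdot>\<^sub>v v"
proof -
  interpret cof_vec_space n "TYPE(real)" .
  define ws where "ws = gram_schmidt n (basis_completion v)"
  note b = basis_completion[OF v]
  have n: "n > 0"
    using v by (cases n) auto
  then have "basis_completion v = v # tl (basis_completion v)"
    using b(6,7) by (cases "basis_completion v") auto
  then have hd: "hd ws = v"
    unfolding ws_def using gram_schmidt_hd[OF v(1)] by metis
  have ws: "set ws \<subseteq> carrier_vec n" "corthogonal ws" "length ws = n"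
    using gram_schmidt_result[OF b(2,4,5) ws_def] b(6) by auto
  have cnj: "conjugate x = x" for x :: "real vec"
    by (intro eq_vecI) auto
  have carr: "ws ! i \<in> carrier_vec n" if "i < n" for i
    using ws that by auto
  have orth: "ws ! i \<bullet> ws ! j = 0 \<longleftrightarrow> i \<noteq> j" if "i < n" "j < n" for i j
    using corthogonalD[OF ws(2)] ws(3) that by (simp add: cnj)
  have pos: "ws ! i \<bullet> ws ! i > 0" if "i < n" for i
    using orth[OF that that]
    by (auto simp: scalar_prod_def less_le intro!: sum_nonneg)
  define f where "f i = 1 / sqrt (ws ! i \<bullet> ws ! i)" for i
  define W where "W = mat_of_cols n (map (\<lambda>i. f i \<cdot>\<^sub>v ws ! i) [0..<n])"
  have W: "W \<in> carrier_mat n n"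
    using mat_of_cols_carrier(1)[of n "map (\<lambda>i. f i \<cdot>\<^sub>v ws ! i) [0..<n]"] by (simp add: W_def)
  have col: "col W i = f i \<cdot>\<^sub>v ws ! i" if "i < n" for i
    unfolding W_def using that carr by (subst col_mat_of_cols) auto
  have "W\<^sup>T * W = 1\<^sub>m n"
  proof (rule eq_matI)
    fix i j assume ij: "i < dim_row (1\<^sub>m n :: real mat)" "j < dim_col (1\<^sub>m n :: real mat)"
    then have "(W\<^sup>T * W) $$ (i, j) = f i * f j * (ws ! i \<bullet> ws ! j)"
      using W carr[of i] carr[of j] by (simp add: col)
    also have "\<dots> = 1\<^sub>m n $$ (i, j)"
      using ij orth pos[of i] by (auto simp: f_def less_imp_le)
    finally show "(W\<^sup>T * W) $$ (i, j) = 1\<^sub>m n $$ (i, j)" .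
  qed (use W in auto)
  moreover have "col W 0 = f 0 \<cdot>\<^sub>v v"
    using col[OF n] hd n ws(3) by (cases ws) auto
  ultimately show ?thesis
    using W by blast
qed

text \<open>Induction on the dimension: in an orthonormal basis starting with an eigenvector the
  matrix splits into a 1 by 1 block and a smaller symmetric block, which the induction hypothesis
  diagonalizes.\<close>

theorem symmetric_mat_orthogonally_diagonalizable:
  fixes A :: "real mat"
  assumes "A \<in> carrier_mat n n" and "A\<^sup>T = A"
  shows "\<exists>P f. P \<in> carrier_mat n n \<and> P\<^sup>T * P = 1\<^sub>m n \<and> P\<^sup>T * A * P = mat_diag n f"
  using assms
proof (induction n arbitrary: A)
  case 0
  then show ?case
    by (intro exI[of _ "1\<^sub>m 0"] exI[of _ "\<lambda>_. 0"]) (auto simp: mat_diag_def)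
next
  case (Suc n)
  note A = Suc.prems(1) and sym = Suc.prems(2)
  note mat_rules = mult_carrier_mat[of _ "Suc n" "Suc n" _ "Suc n"]
    assoc_mult_mat[of _ "Suc n" "Suc n" _ "Suc n" _ "Suc n"]
    transpose_mult[of _ "Suc n" "Suc n" _ "Suc n"]
  obtain e v where v: "v \<in> carrier_vec (Suc n)" "v \<noteq> 0\<^sub>v (Suc n)" and Av: "A *\<^sub>v v = e \<cdot>\<^sub>v v"
    using symmetric_mat_has_real_eigenvalue[OF A sym] A
    unfolding eigenvalue_def eigenvector_def by auto
  obtain W t where W: "W \<in> carrier_mat (Suc n) (Suc n)" and WW: "W\<^sup>T * W = 1\<^sub>m (Suc n)"
    and col: "col W 0 = t \<cdot>\<^sub>v v"
    using orthonormal_mat_completion[OF v] by blast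
  define B where "B = W\<^sup>T * A * W"
  have B: "B \<in> carrier_mat (Suc n) (Suc n)"
    using A W by (simp add: B_def)
  have symB: "B\<^sup>T = B"
    using A W sym by (simp add: B_def mat_rules)
  \<comment> \<open>The first column of \<open>W\<close> is a multiple of the eigenvector, so the
    first column of \<open>B\<close> is \<open>e\<close> times the first unit vector. By symmetry
    the first row has the same form.\<close>
  have "col B 0 = W\<^sup>T *\<^sub>v (A *\<^sub>v col W 0)"
  proof -
    have "B = W\<^sup>T * (A * W)"
      using A W by (simp add: B_def mat_rules)
    then show ?thesis
      using col_mult2[of "W\<^sup>T" "Suc n" "Suc n" "A * W" "Suc n" 0] col_mult2[OF A W, of 0] A W by simp
  qed
  also have "\<dots> = e \<cdot>\<^sub>v (W\<^sup>T *\<^sub>v col W 0)"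
    using A W v by (simp add: col Av mult_mat_vec[where nc = "Suc n"] smult_smult_assoc mult.commute)
  also have "\<dots> = e \<cdot>\<^sub>v col (W\<^sup>T * W) 0"
    using W by (subst col_mult2[of _ "Suc n" "Suc n" _ "Suc n"]) auto
  finally have "col B 0 = e \<cdot>\<^sub>v col (W\<^sup>T * W) 0" .
  then have col0: "col B 0 = e \<cdot>\<^sub>v unit_vec (Suc n) 0"
    by (simp add: WW)
  have B0: "B $$ (i, 0) = (if i = 0 then e else 0)" if "i < Suc n" for i
    using that B arg_cong[OF col0, of "\<lambda>x. x $ i"] by auto
  have symB': "B $$ (i, j) = B $$ (j, i)" if "i < Suc n" "j < Suc n" for i j
    using arg_cong[OF symB, of "\<lambda>M. M $$ (j, i)"] that B by simp
  define C where "C = mat n n (\<lambda>(i, j). B $$ (Suc i, Suc j))"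
  have C: "C \<in> carrier_mat n n" "C\<^sup>T = C"
    by (auto simp: C_def symB' intro!: eq_matI)
  obtain P f where P: "P \<in> carrier_mat n n" "P\<^sup>T * P = 1\<^sub>m n" "P\<^sup>T * C * P = mat_diag n f"
    using Suc.IH[OF C] by blast
  have Bblock: "B = four_block_mat (mat_diag 1 (\<lambda>_. e)) (0\<^sub>m 1 n) (0\<^sub>m n 1) C"
    using B B0 symB'[of 0] by (intro eq_matI) (auto simp: C_def mat_diag_def four_block_mat_def Let_def)
  define U where "U = four_block_mat (1\<^sub>m 1) (0\<^sub>m 1 n) (0\<^sub>m n 1) P"
  have U: "U \<in> carrier_mat (Suc n) (Suc n)"
    using four_block_carrier_mat[of "1\<^sub>m 1" 1 1 P n n] P by (simp add: U_def)
  have UT: "U\<^sup>T = four_block_mat (1\<^sub>m 1) (0\<^sub>m 1 n) (0\<^sub>m n 1) P\<^sup>T"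
    using P by (simp add: U_def transpose_four_block_mat[of _ 1 1 _ n _ n])
  have UU: "U\<^sup>T * U = 1\<^sub>m (Suc n)"
    unfolding UT unfolding U_def using P
    by (subst mult_four_block_mat[of _ 1 1 _ n _ n _ _ 1 _ n]) auto
  have UBU: "U\<^sup>T * B * U = mat_diag (Suc n) (case_nat e f)"
  proof -
    have "U\<^sup>T * B * U = four_block_mat (mat_diag 1 (\<lambda>_. e)) (0\<^sub>m 1 n) (0\<^sub>m n 1) (P\<^sup>T * C * P)"
      unfolding UT Bblock unfolding U_def using P C
      by (subst mult_four_block_mat[of _ 1 1 _ n _ n _ _ 1 _ n],
          auto simp del: One_nat_def simp: left_mult_one_mat[of _ 1 1]
          left_mult_zero_mat[of _ 1 1] right_mult_one_mat[of _ 1 1] right_mult_zero_mat[of _ 1 1])+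
    then show ?thesis
      by (auto simp: P(3) mat_diag_def four_block_mat_def Let_def split: nat.splits intro!: eq_matI)
  qed
  show ?case
  proof (intro exI conjI)
    show "W * U \<in> carrier_mat (Suc n) (Suc n)"
      using W U by simp
    have "(W * U)\<^sup>T * (W * U) = U\<^sup>T * (W\<^sup>T * W) * U"
      using W U by (simp add: mat_rules)
    then show "(W * U)\<^sup>T * (W * U) = 1\<^sub>m (Suc n)"
      using U by (simp add: WW UU)
    have "(W * U)\<^sup>T * A * (W * U) = U\<^sup>T * B * U"
      using W U A by (simp add: B_def mat_rules)
    then show "(W * U)\<^sup>T * A * (W * U) = mat_diag (Suc n) (case_nat e f)"
      by (simp add: UBU)
  qed
qed


section \<open>Eigenvalues outside [-1, 1] and vectors that are not expanded\<close>

text \<open>Padded with zero rows, the vectors form a singular square matrix; any nonzero kernel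
  vector will do.\<close>

lemma exists_nonzero_vec_orthogonal_to_few:
  fixes rs :: "'a :: field vec list"
  assumes rs: "set rs \<subseteq> carrier_vec n" and len: "length rs < n"
  shows "\<exists>x \<in> carrier_vec n. x \<noteq> 0\<^sub>v n \<and> (\<forall>r \<in> set rs. r \<bullet> x = 0)"
proof -
  define c where "c i = (if i < length rs then rs ! i else 0\<^sub>v n)" for i
  \<comment> \<open>The last row is set to zero explicitly to match \<open>det_row_0\<close>. No
    vector is lost, since the list fills at most the first \<open>n - 1\<close> rows.\<close>
  define M where "M = mat\<^sub>r n n (\<lambda>i. if i = n - 1 then 0\<^sub>v n else c i)"
  have c: "c i \<in> carrier_vec n" for i
    using rs by (auto simp: c_def)
  have M: "M \<in> carrier_mat n n"
    by (simp add: M_def)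
  have "det M = 0"
    unfolding M_def using len c by (intro det_row_0) auto
  then obtain x where x: "x \<in> carrier_vec n" "x \<noteq> 0\<^sub>v n" "M *\<^sub>v x = 0\<^sub>v n"
    using det_0_iff_vec_prod_zero[OF M] by blast
  have "rs ! i \<bullet> x = 0" if i: "i < length rs" for i
  proof -
    have "row M i = rs ! i"
      using i len c[of i] by (auto simp: M_def c_def intro!: eq_vecI)
    then have "rs ! i \<bullet> x = (M *\<^sub>v x) $ i"
      using i len M by simp
    then show ?thesis
      using i len by (simp add: x)
  qed
  then have "\<forall>r \<in> set rs. r \<bullet> x = 0"
    by (metis in_set_conv_nth)
  then show ?thesis
    using x by blast
qed

lemma orthonormal_mat_scalar_prod:
  fixes P :: "real mat"
  assumes P: "P \<in> carrier_mat n n" "P\<^sup>T * P = 1\<^sub>m n" and x: "x \<in> carrier_vec n"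
  shows "(P *\<^sub>v x) \<bullet> (P *\<^sub>v x) = x \<bullet> x"
proof -
  have "(P *\<^sub>v x) \<bullet> (P *\<^sub>v x) = (P\<^sup>T *\<^sub>v (P *\<^sub>v x)) \<bullet> x"
    using transpose_vec_mult_scalar[OF P(1) x, of "P *\<^sub>v x"] P(1) x by simp
  also have "P\<^sup>T *\<^sub>v (P *\<^sub>v x) = (P\<^sup>T * P) *\<^sub>v x"
    using P(1) x by (intro assoc_mult_mat_vec[symmetric]) auto
  finally show ?thesis
    using x by (simp add: P(2))
qed

lemma proots_prod_linear_factors:
  fixes as :: "'a :: idom list"
  shows "proots (\<Prod>a\<leftarrow>as. [:- a, 1:]) = mset as"
proof (induction as)
  case (Cons a as)
  have "(\<Prod>a\<leftarrow>as. [:- a, 1:]) \<noteq> 0"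
    by (auto simp: prod_list_zero_iff)
  then have "proots ([:- a, 1:] * (\<Prod>a\<leftarrow>as. [:- a, 1:])) = {#a#} + mset as"
    by (subst proots_mult) (auto simp: Cons.IH simp del: mult_pCons_left)
  then show ?case
    by (simp del: mult_pCons_left)
qed simp

text \<open>Vanishing outside \<open>I\<close> imposes \<open>n - card I\<close> linear conditions,
  and orthogonality to the eigenvectors for eigenvalues outside [-1, 1] fewer than
  \<open>card I\<close> more. These are fewer than \<open>n\<close> in total, so a nonzero solution
  exists; only eigenvalues of modulus at most 1 act on it.\<close>

lemma symmetric_mat_not_expanding_on_coordinates:
  fixes A :: "real mat"
  assumes A: "A \<in> carrier_mat n n" "A\<^sup>T = A" and I: "I \<subseteq> {..<n}"
    and few: "size {#x \<in># proots (char_poly A). x \<notin> {-1..1}#} < card I"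
  shows "\<exists>x \<in> carrier_vec n. x \<noteq> 0\<^sub>v n \<and> (\<forall>i<n. i \<notin> I \<longrightarrow> x $ i = 0) \<and>
    (A *\<^sub>v x) \<bullet> (A *\<^sub>v x) \<le> x \<bullet> x"
proof -
  obtain P f where P: "P \<in> carrier_mat n n" "P\<^sup>T * P = 1\<^sub>m n" and diag: "P\<^sup>T * A * P = mat_diag n f"
    using symmetric_mat_orthogonally_diagonalizable[OF A] by blast
  let ?D = "mat_diag n f"
  have PT: "P\<^sup>T \<in> carrier_mat n n"
    using P by simp
  have PPT: "P * P\<^sup>T = 1\<^sub>m n"
    using mat_mult_left_right_inverse[OF PT P(1) P(2)] .
  have AD: "A = P * ?D * P\<^sup>T"
  proof -
    have "P * (P\<^sup>T * A * P) * P\<^sup>T = (P * P\<^sup>T) * A * (P * P\<^sup>T)"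
      using A P by (simp add: mult_carrier_mat[of _ n n _ n] assoc_mult_mat[of _ n n _ n _ n])
    then show ?thesis
      using A by (simp add: PPT diag)
  qed
  have "similar_mat_wit A ?D P P\<^sup>T"
    by (rule similar_mat_witI[OF PPT P(2) AD]) (use A P in auto)
  then have "char_poly A = char_poly ?D"
    unfolding similar_mat_def[symmetric] by (metis char_poly_similar similar_mat_def)
  also have "\<dots> = (\<Prod>a\<leftarrow>diag_mat ?D. [:- a, 1:])"
    by (rule char_poly_upper_triangular[OF mat_diag_dim]) (auto simp: mat_diag_def)
  also have "diag_mat ?D = map f [0..<n]"
    by (auto simp: diag_mat_def mat_diag_def)
  finally have "proots (char_poly A) = mset (map f [0..<n])"
    by (simp only: proots_prod_linear_factors)
  moreover define big where "big = filter (\<lambda>i. f i \<notin> {-1..1}) [0..<n]"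
  ultimately have "{#x \<in># proots (char_poly A). x \<notin> {-1..1}#} = mset (map f big)"
    by (simp only: mset_filter filter_map o_def flip: mset_filter)
  then have big: "length big < card I"
    using few by (simp only: size_mset length_map)
  define out where "out = filter (\<lambda>i. i \<notin> I) [0..<n]"
  have "length out = n - card I"
  proof -
    have "length out = card ({..<n} - I)"
      unfolding out_def by (subst distinct_card[symmetric]) (auto intro: arg_cong[of _ _ card])
    then show ?thesis
      using I by (simp add: card_Diff_subset finite_subset)
  qed
  moreover have "card I \<le> n"
    using card_mono[OF _ I] by simp
  ultimately have "length (map (unit_vec n) out @ map (col P) big) < n"
    using big by simp
  moreover have "set (map (unit_vec n) out @ map (col P) big) \<subseteq> carrier_vec n"
    using P by auto
  ultimately obtain x where x: "x \<in> carrier_vec n" "x \<noteq> 0\<^sub>v n"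
    and orth: "\<forall>r \<in> set (map (unit_vec n) out @ map (col P) big). r \<bullet> x = 0"
    using exists_nonzero_vec_orthogonal_to_few by blast
  have supp: "x $ i = 0" if "i < n" "i \<notin> I" for i
  proof -
    have "unit_vec n i \<bullet> x = 0"
      using orth that by (simp add: out_def)
    then show ?thesis
      using x that by simp
  qed
  \<comment> \<open>The coordinates of \<open>x\<close> in the orthonormal eigenbasis; those
    belonging to eigenvalues outside [-1, 1] vanish.\<close>
  define y where "y = P\<^sup>T *\<^sub>v x"
  have y: "y \<in> carrier_vec n"
    using P x by (simp add: y_def)
  have y0: "y $ i = 0" if "i < n" "f i \<notin> {-1..1}" for i
    using orth that P by (auto simp: y_def big_def)
  have "A *\<^sub>v x = P *\<^sub>v (?D *\<^sub>v y)"
    using P x by (simp add: AD y_def mult_carrier_mat[of _ n n _ n] assoc_mult_mat_vec[of _ n n _ n])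
  then have "(A *\<^sub>v x) \<bullet> (A *\<^sub>v x) = (?D *\<^sub>v y) \<bullet> (?D *\<^sub>v y)"
    using orthonormal_mat_scalar_prod[OF P, of "?D *\<^sub>v y"] y
      mult_mat_vec_carrier[OF mat_diag_dim[of n f] y] by simp
  also have "?D *\<^sub>v y = vec n (\<lambda>i. f i * y $ i)"
    using y by (auto simp: mat_diag_def scalar_prod_def if_distrib if_distribR sum.If_cases
        intro!: eq_vecI cong: if_cong)
  also have "vec n (\<lambda>i. f i * y $ i) \<bullet> vec n (\<lambda>i. f i * y $ i) \<le> y \<bullet> y"
  proof -
    have "f i * y $ i * (f i * y $ i) \<le> y $ i * y $ i" if "i < n" for i
    proof (cases "f i \<in> {-1..1}")
      case True
      then have "(f i)\<^sup>2 \<le> 1"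
        by (auto simp: abs_square_le_1)
      then have "(f i)\<^sup>2 * (y $ i)\<^sup>2 \<le> 1 * (y $ i)\<^sup>2"
        by (intro mult_right_mono) auto
      then show ?thesis
        by (simp add: power2_eq_square algebra_simps)
    qed (use y0 that in auto)
    then show ?thesis
      using y by (auto simp: scalar_prod_def intro!: sum_mono)
  qed
  also have "y \<bullet> y = x \<bullet> x"
    unfolding y_def using orthonormal_mat_scalar_prod[OF PT _ x(1)] PPT by simp
  finally show ?thesis
    using x supp by blast
qed

section \<open>Matrices with zero diagonal and off-diagonal entries of modulus one\<close>

text \<open>Each mixed term is at least minus the sum of its two squares, and each variable occurs
  in two of them. So the left side is at least twice the sum of squares.\<close>

lemma three_quadratic_bound:
  fixes x y z p q r :: real
  assumes "\<bar>p\<bar> \<le> 1" "\<bar>q\<bar> \<le> 1" "\<bar>r\<bar> \<le> 1"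
    and "4 * (x\<^sup>2 + y\<^sup>2 + z\<^sup>2) + 2 * (p * (x * y) + q * (x * z) + r * (y * z)) \<le> x\<^sup>2 + y\<^sup>2 + z\<^sup>2"
  shows "x = 0 \<and> y = 0 \<and> z = 0"
proof -
  have *: "- (u\<^sup>2 + v\<^sup>2) \<le> 2 * (t * (u * v))" if "\<bar>t\<bar> \<le> 1" for t u v :: real
  proof -
    have "2 * \<bar>t * (u * v)\<bar> \<le> 2 * \<bar>u * v\<bar>"
      using that by (simp add: abs_mult mult_left_le_one_le)
    also have "\<dots> \<le> u\<^sup>2 + v\<^sup>2"
      using sum_squares_bound[of "\<bar>u\<bar>" "\<bar>v\<bar>"] by (simp add: abs_mult)
    finally show ?thesis
      by linarith
  qed
  have "x\<^sup>2 + y\<^sup>2 + z\<^sup>2 \<le> 0"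
    using *[OF assms(1), of x y] *[OF assms(2), of x z] *[OF assms(3), of y z] assms(4) by argo
  then show ?thesis
    by (smt (verit) zero_le_power2 power2_eq_square mult_eq_0_iff)
qed

text \<open>The five squares are the coordinates of the image of \<open>(x, y, z, 0, 0)\<close>
  under a 5 by 5 Seidel matrix. Here \<open>p\<close>, \<open>q\<close>, \<open>r\<close> are the
  entries among the first three indices, and \<open>a, b, c\<close> and \<open>d, e, f\<close> begin
  the last two rows. The mixed coefficients are inner products of the first three columns.\<close>

lemma gram_five_expansion:
  fixes x y z p q r :: real
  assumes "p\<^sup>2 = 1" "q\<^sup>2 = 1" "r\<^sup>2 = 1" "a\<^sup>2 = 1" "b\<^sup>2 = 1" "c\<^sup>2 = 1" "d\<^sup>2 = 1" "e\<^sup>2 = 1" "f\<^sup>2 = 1"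
  shows "(p * y + q * z)\<^sup>2 + (p * x + r * z)\<^sup>2 + (q * x + r * y)\<^sup>2
      + (a * x + b * y + c * z)\<^sup>2 + (d * x + e * y + f * z)\<^sup>2
    = 4 * (x\<^sup>2 + y\<^sup>2 + z\<^sup>2) + 2 * ((q * r + a * b + d * e) * (x * y)
      + (p * r + a * c + d * f) * (x * z) + (p * q + b * c + e * f) * (y * z))"
proof -
  have "(p * y + q * z)\<^sup>2 + (p * x + r * z)\<^sup>2 + (q * x + r * y)\<^sup>2
      + (a * x + b * y + c * z)\<^sup>2 + (d * x + e * y + f * z)\<^sup>2
    = (p\<^sup>2 + q\<^sup>2 + a\<^sup>2 + d\<^sup>2) * x\<^sup>2 + (p\<^sup>2 + r\<^sup>2 + b\<^sup>2 + e\<^sup>2) * y\<^sup>2 + (q\<^sup>2 + r\<^sup>2 + c\<^sup>2 + f\<^sup>2) * z\<^sup>2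
      + 2 * ((q * r + a * b + d * e) * (x * y)
      + (p * r + a * c + d * f) * (x * z) + (p * q + b * c + e * f) * (y * z))"
    by (simp add: power2_eq_square algebra_simps)
  then show ?thesis
    by (simp add: assms algebra_simps)
qed

lemma three_large_eigenvalues:
  fixes A :: "real mat"
  assumes A: "A \<in> carrier_mat n n" "A\<^sup>T = A"
    and entry: "\<And>i j. i < n \<Longrightarrow> j < n \<Longrightarrow> A $$ (i, j) \<in> (if i = j then {0} else {-1, 1})"
    and lt: "a < n" "b < n" "c < n" "d < n" "e < n"
    and dist: "distinct [a, b, c, d, e]"
    and ab: "\<bar>A $$ (a, c) * A $$ (b, c) + A $$ (a, d) * A $$ (b, d) + A $$ (a, e) * A $$ (b, e)\<bar> \<le> 1"
    and ac: "\<bar>A $$ (a, b) * A $$ (c, b) + A $$ (a, d) * A $$ (c, d) + A $$ (a, e) * A $$ (c, e)\<bar> \<le> 1"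
    and bc: "\<bar>A $$ (b, a) * A $$ (c, a) + A $$ (b, d) * A $$ (c, d) + A $$ (b, e) * A $$ (c, e)\<bar> \<le> 1"
  shows "size {#x \<in># proots (char_poly A). x \<notin> {-1..1}#} \<ge> 3"
proof (rule ccontr)
  assume "\<not> ?thesis"
  then have few: "size {#x \<in># proots (char_poly A). x \<notin> {-1..1}#} < card {a, b, c}"
    using dist by simp
  have "{a, b, c} \<subseteq> {..<n}"
    using lt by simp
  from symmetric_mat_not_expanding_on_coordinates[OF A this few] obtain x where
    x: "x \<in> carrier_vec n" "x \<noteq> 0\<^sub>v n" and supp: "\<And>i. i < n \<Longrightarrow> i \<notin> {a, b, c} \<Longrightarrow> x $ i = 0"
    and le: "(A *\<^sub>v x) \<bullet> (A *\<^sub>v x) \<le> x \<bullet> x"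
    by blast
  have sum3: "(\<Sum>i = 0..<n. g i * x $ i) = g a * x $ a + g b * x $ b + g c * x $ c" for g
  proof -
    have "(\<Sum>i = 0..<n. g i * x $ i) = (\<Sum>i \<in> {a, b, c}. g i * x $ i)"
      using lt supp by (intro sum.mono_neutral_right) auto
    then show ?thesis
      using dist by simp
  qed
  define s where "s i = A $$ (i, a) * x $ a + A $$ (i, b) * x $ b + A $$ (i, c) * x $ c" for i
  have Ax: "(A *\<^sub>v x) $ i = s i" if "i < n" for i
    using that A x by (simp add: scalar_prod_def sum3 s_def)
  \<comment> \<open>Discarding all rows but five can only shorten the image, so the 5 by 5
    computation bounds it from below for every \<open>n\<close>.\<close>
  have "(\<Sum>i \<in> {a, b, c, d, e}. (s i)\<^sup>2) \<le> (\<Sum>i = 0..<n. (s i)\<^sup>2)"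
    using lt by (intro sum_mono2) auto
  also have "\<dots> = (A *\<^sub>v x) \<bullet> (A *\<^sub>v x)"
    using A x Ax by (auto simp: scalar_prod_def power2_eq_square simp del: index_mult_mat_vec)
  also have "\<dots> \<le> (x $ a)\<^sup>2 + (x $ b)\<^sup>2 + (x $ c)\<^sup>2"
    using le x sum3[of "($) x"] by (simp add: scalar_prod_def power2_eq_square)
  finally have main: "(s a)\<^sup>2 + (s b)\<^sup>2 + (s c)\<^sup>2 + (s d)\<^sup>2 + (s e)\<^sup>2 \<le> (x $ a)\<^sup>2 + (x $ b)\<^sup>2 + (x $ c)\<^sup>2"
    using dist by simp
  have sym: "A $$ (i, j) = A $$ (j, i)" if "i < n" "j < n" for i j
    using arg_cong[OF A(2), of "\<lambda>M. M $$ (j, i)"] that A(1) by simp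
  have sq: "(A $$ (i, j))\<^sup>2 = (if i = j then 0 else 1)" if "i < n" "j < n" for i j
    using entry[OF that] by auto
  have "(s a)\<^sup>2 + (s b)\<^sup>2 + (s c)\<^sup>2 + (s d)\<^sup>2 + (s e)\<^sup>2 =
    4 * ((x $ a)\<^sup>2 + (x $ b)\<^sup>2 + (x $ c)\<^sup>2) +
    2 * ((A $$ (a, c) * A $$ (b, c) + A $$ (a, d) * A $$ (b, d) + A $$ (a, e) * A $$ (b, e)) * (x $ a * x $ b)
       + (A $$ (a, b) * A $$ (c, b) + A $$ (a, d) * A $$ (c, d) + A $$ (a, e) * A $$ (c, e)) * (x $ a * x $ c)
       + (A $$ (b, a) * A $$ (c, a) + A $$ (b, d) * A $$ (c, d) + A $$ (b, e) * A $$ (c, e)) * (x $ b * x $ c))"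
  proof -
    have "s a = A $$ (a, b) * x $ b + A $$ (a, c) * x $ c"
      "s b = A $$ (a, b) * x $ a + A $$ (b, c) * x $ c"
      "s c = A $$ (a, c) * x $ a + A $$ (b, c) * x $ b"
      "s d = A $$ (a, d) * x $ a + A $$ (b, d) * x $ b + A $$ (c, d) * x $ c"
      "s e = A $$ (a, e) * x $ a + A $$ (b, e) * x $ b + A $$ (c, e) * x $ c"
      using entry[of a a] entry[of b b] entry[of c c] lt
        sym[of b a] sym[of c a] sym[of c b] sym[of d a] sym[of d b] sym[of d c]
        sym[of e a] sym[of e b] sym[of e c]
      by (auto simp: s_def)
    moreover have "A $$ (c, b) = A $$ (b, c)" "A $$ (b, a) = A $$ (a, b)" "A $$ (c, a) = A $$ (a, c)"
      using lt sym by auto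
    \<comment> \<open>The instantiation follows the order of occurrence in the lemma, where
      \<open>y\<close> and \<open>z\<close> precede \<open>x\<close>.\<close>
    ultimately show ?thesis
      using gram_five_expansion[of "A $$ (a, b)" "A $$ (a, c)" "A $$ (b, c)" "A $$ (a, d)" "A $$ (b, d)"
        "A $$ (c, d)" "A $$ (a, e)" "A $$ (b, e)" "A $$ (c, e)" "x $ b" "x $ c" "x $ a"] lt dist
      by (simp add: sq)
  qed
  with main three_quadratic_bound[OF ab ac bc] have "x $ a = 0 \<and> x $ b = 0 \<and> x $ c = 0"
    by simp
  then have "x = 0\<^sub>v n"
    using x supp by (intro eq_vecI) (metis carrier_vecD empty_iff index_zero_vec insert_iff)+
  with x show False
    by simp
qed

section \<open>Switching and forbidden five-vertex configurations\<close>

text \<open>A sum of three signs has modulus 1 rather than 3 exactly in this case.\<close>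

definition not_all_equal :: "bool \<Rightarrow> bool \<Rightarrow> bool \<Rightarrow> bool" where
  "not_all_equal p q r \<longleftrightarrow> \<not> (p = q \<and> q = r)"

text \<open>
  \<open>R a k = R b k\<close> says that the Seidel entries \<open>ak\<close> and \<open>bk\<close> have product 1, so the three conditions
  say that the inner products of the rows \<open>a, b, c\<close> within \<open>{a, b, c, d, e}\<close> are not \<open>\<plusminus>3\<close>.
\<close>

definition small_inner_triple :: "('a \<Rightarrow> 'a \<Rightarrow> bool) \<Rightarrow> 'a \<Rightarrow> 'a \<Rightarrow> 'a \<Rightarrow> 'a \<Rightarrow> 'a \<Rightarrow> bool" where
  "small_inner_triple R a b c d e \<longleftrightarrow>
     not_all_equal (R a c = R b c) (R a d = R b d) (R a e = R b e) \<and>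
     not_all_equal (R a b = R c b) (R a d = R c d) (R a e = R c e) \<and>
     not_all_equal (R b a = R c a) (R b d = R c d) (R b e = R c e)"

lemma pair_graph_arcs:
  assumes "pair_graph G"
  shows "(x, x) \<notin> parcs G" and "(x, y) \<in> parcs G \<longleftrightarrow> (y, x) \<in> parcs G"
    and "(x, y) \<in> parcs G \<Longrightarrow> x \<in> pverts G \<and> y \<in> pverts G"
proof -
  interpret pair_graph G by fact
  show "(x, x) \<notin> parcs G"
    using pair_no_loops[of "(x, x)"] by auto
  show "(x, y) \<in> parcs G \<longleftrightarrow> (y, x) \<in> parcs G"
    using arcs_symmetric[of x y] arcs_symmetric[of y x] by blast
  show "(x, y) \<in> parcs G \<Longrightarrow> x \<in> pverts G \<and> y \<in> pverts G"
    using in_arcsD1 in_arcsD2 by blast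
qed

lemma pverts_switch [simp]: "pverts (switch G X) = pverts G"
  by (simp add: switch_def)

lemma parcs_switch:
  "(u, v) \<in> parcs (switch G X) \<longleftrightarrow> u \<in> pverts G \<and> v \<in> pverts G \<and>
     ((u, v) \<in> parcs G \<longleftrightarrow> (u \<in> X \<longleftrightarrow> v \<in> X))"
  by (auto simp: switch_def)

lemma pair_graph_switch:
  assumes "pair_graph G"
  shows "pair_graph (switch G X)"
proof -
  interpret pair_graph G by fact
  note arcs = pair_graph_arcs[OF assms]
  have "parcs (switch G X) \<subseteq> pverts G \<times> pverts G"
    by (auto simp: parcs_switch)
  then have "finite (parcs (switch G X))"
    using pair_finite_verts finite_subset by blast
  moreover have "symmetric (with_proj (switch G X))"
    using arcs(2) by (auto simp: symmetric_def sym_def parcs_switch)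
  ultimately show ?thesis
    using arcs(1) pair_finite_verts
    by unfold_locales (auto simp: parcs_switch)
qed

text \<open>In comparing two rows the sign of the common column cancels, and the signs of the rows
  negate either all three comparisons or none.\<close>

lemma small_inner_triple_switch:
  assumes "{a, b, c, d, e} \<subseteq> pverts G"
  shows "small_inner_triple (\<lambda>x y. (x, y) \<in> parcs (switch G X)) a b c d e \<longleftrightarrow>
    small_inner_triple (\<lambda>x y. (x, y) \<in> parcs G) a b c d e"
proof -
  have "((x, z) \<in> parcs (switch G X) \<longleftrightarrow> (y, z) \<in> parcs (switch G X)) \<longleftrightarrow>
    (((x, z) \<in> parcs G \<longleftrightarrow> (y, z) \<in> parcs G) \<longleftrightarrow> (x \<in> X \<longleftrightarrow> y \<in> X))"
    if "x \<in> pverts G" "y \<in> pverts G" "z \<in> pverts G" for x y z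
    using that by (auto simp: parcs_switch)
  moreover have "not_all_equal (p = t) (q = t) (r = t) = not_all_equal p q r" for p q r t
    by (auto simp: not_all_equal_def)
  ultimately show ?thesis
    using assms by (simp add: small_inner_triple_def)
qed

section \<open>Classification of the graphs without forbidden configurations\<close>

text \<open>Without an induced path on three vertices the graph minus \<open>v\<close> is a disjoint
  union of cliques, and excluding \<open>2K2\<close> leaves at most one with an edge. Otherwise it
  is complete multipartite, and excluding \<open>C4\<close> leaves at most one part with several
  vertices.\<close>

lemma clique_or_co_clique:
  fixes R :: "'a \<Rightarrow> 'a \<Rightarrow> bool"
  assumes sym: "\<And>x y. R x y \<longleftrightarrow> R y x" and irrefl: "\<And>x. \<not> R x x"
    and v: "v \<in> V" "\<And>x. \<not> R v x"
    and free: "\<And>a b c d e. {a, b, c, d, e} \<subseteq> V \<Longrightarrow> distinct [a, b, c, d, e] \<Longrightarrow>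
      \<not> small_inner_triple R a b c d e"
  shows "\<exists>K \<subseteq> V - {v}.
    (\<forall>x \<in> V - {v}. \<forall>y \<in> V - {v}. R x y \<longleftrightarrow> x \<noteq> y \<and> x \<in> K \<and> y \<in> K) \<or>
    (\<forall>x \<in> V - {v}. \<forall>y \<in> V - {v}. R x y \<longleftrightarrow> x \<noteq> y \<and> \<not> (x \<in> K \<and> y \<in> K))"
proof -
  let ?V = "V - {v}"
  have v': "\<not> R x v" for x
    using v sym by blast
  note simps = small_inner_triple_def not_all_equal_def v(2) v' irrefl
  txt \<open>
    With \<open>v\<close> added, each forbidden graph except \<open>P\<^sub>4\<close> falls into two pairs of vertices with inner
    product \<open>\<plusminus>3\<close> and a single vertex; the triples chosen below are transversals.
  \<close>
  have no_C4: False if "{a, b, c, d} \<subseteq> ?V" "distinct [a, b, c, d]"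
    "R a b" "R b c" "R c d" "R d a" "\<not> R a c" "\<not> R b d" for a b c d
  proof -
    have "\<not> small_inner_triple R a b v c d"
      using that v by (intro free) auto
    then show False
      using that sym[of a d] sym[of a b] by (simp add: simps)
  qed
  have no_2K2: False if "{a, b, c, d} \<subseteq> ?V" "distinct [a, b, c, d]"
    "R a b" "R c d" "\<not> R a c" "\<not> R a d" "\<not> R b c" "\<not> R b d" for a b c d
  proof -
    have "\<not> small_inner_triple R a c v b d"
      using that v by (intro free) auto
    then show False
      using that sym by (simp add: simps)
  qed
  have no_P3_K1: False if "{a, b, c, d} \<subseteq> ?V" "distinct [a, b, c, d]"
    "R a b" "R b c" "\<not> R a c" "\<not> R a d" "\<not> R b d" "\<not> R c d" for a b c d
  proof -
    have "\<not> small_inner_triple R a b d c v"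
      using that v by (intro free) auto
    then show False
      using that sym by (simp add: simps)
  qed
  \<comment> \<open>\<open>P4\<close> plus \<open>v\<close> switches to a 5-cycle, where all pairs
    of rows have inner product 1 or -1; hence any triple serves.\<close>
  have no_P4: False if "{a, b, c, d} \<subseteq> ?V" "distinct [a, b, c, d]"
    "R a b" "R b c" "R c d" "\<not> R a c" "\<not> R a d" "\<not> R b d" for a b c d
  proof -
    have "\<not> small_inner_triple R a b c d v"
      using that v by (intro free) auto
    then show False
      using that sym by (simp add: simps)
  qed
  have no_paw: False if "{a, b, c, d} \<subseteq> ?V" "distinct [a, b, c, d]"
    "R a b" "R b c" "R a c" "R a d" "\<not> R b d" "\<not> R c d" for a b c d
  proof -
    have "\<not> small_inner_triple R b d a c v"
      using that v by (intro free) auto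
    then show False
      using that sym by (simp add: simps)
  qed
  show ?thesis
  proof (cases "\<exists>a \<in> ?V. \<exists>b \<in> ?V. \<exists>c \<in> ?V. R a b \<and> R b c \<and> a \<noteq> c \<and> \<not> R a c")
    case False
    then have trans: "R x z" if "{x, y, z} \<subseteq> ?V" "R x y" "R y z" "x \<noteq> z" for x y z
      using that by blast
    let ?K = "{x \<in> ?V. \<exists>y \<in> ?V. R x y}"
    \<comment> \<open>By transitivity any edge between \<open>{x, x'}\<close> and
      \<open>{y, y'}\<close> would force \<open>x\<close> and \<open>y\<close> to be adjacent, so
      the two edges would induce \<open>2K2\<close>.\<close>
    have clique: "R x y" if K: "x \<in> ?K" "y \<in> ?K" and "x \<noteq> y" for x y
    proof (rule ccontr)
      assume xy: "\<not> R x y"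
      obtain x' y' where x': "x' \<in> ?V" "R x x'" and y': "y' \<in> ?V" "R y y'"
        using K by blast
      have xy': "\<not> R x y'"
        using trans[of x y' y] K y' xy sym[of y y'] \<open>x \<noteq> y\<close> by auto
      moreover have "\<not> R x' y"
        using trans[of x x' y] K x' xy \<open>x \<noteq> y\<close> by auto
      moreover have ne: "x' \<noteq> y'" "x' \<noteq> y" "y' \<noteq> x"
        using x' y' xy xy' sym[of y x] by auto
      moreover have "\<not> R x' y'"
        using trans[of x x' y'] K x' y' xy' ne by auto
      ultimately show False
        using no_2K2[of x x' y y'] K x' y' xy \<open>x \<noteq> y\<close> irrefl by auto
    qed
    have "R x y \<longleftrightarrow> x \<noteq> y \<and> x \<in> ?K \<and> y \<in> ?K" if "x \<in> ?V" "y \<in> ?V" for x y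
      using that clique[of x y] irrefl sym[of x y] by auto
    then have "\<forall>x \<in> ?V. \<forall>y \<in> ?V. R x y \<longleftrightarrow> x \<noteq> y \<and> x \<in> ?K \<and> y \<in> ?K"
      by blast
    moreover have "?K \<subseteq> ?V"
      by blast
    ultimately show ?thesis
      by (intro exI[of _ ?K] conjI disjI1)
  next
    case True
    then obtain a b c where abc: "{a, b, c} \<subseteq> ?V" "R a b" "R b c" "a \<noteq> c" "\<not> R a c"
      by blast
    \<comment> \<open>If \<open>d\<close> misses the centre \<open>b\<close>, it completes the path
      to \<open>P3 + K1\<close>, \<open>C4\<close> or \<open>P4\<close>, according to whether it
      sees none, both or one of the ends.\<close>
    have dominating: "R b d" if d: "d \<in> ?V" "d \<noteq> b" for d
    proof (rule ccontr)
      assume "\<not> R b d"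
      then have "distinct [a, b, c, d]" "\<not> R d b"
        using abc d irrefl sym by auto
      then show False
        using abc d \<open>\<not> R b d\<close> sym no_P3_K1[of a b c d] no_C4[of a b c d] no_P4[of a b c d] no_P4[of c b a d]
        by auto
    qed
    \<comment> \<open>Nonadjacency is transitive: otherwise the triangle \<open>b\<close>,
      \<open>x\<close>, \<open>y\<close> with \<open>z\<close> attached to \<open>b\<close> would be
      a paw.\<close>
    have co: "R x z \<or> R y z" if "{x, y, z} \<subseteq> ?V" "R x y" "z \<noteq> x" "z \<noteq> y" for x y z
    proof (rule ccontr)
      assume n: "\<not> (R x z \<or> R y z)"
      have "x \<noteq> b" "y \<noteq> b" "z \<noteq> b"
        using n that dominating[of x] dominating[of y] dominating[of z] sym[of z] by auto
      then show False
        using no_paw[of b x y z] dominating abc that n irrefl by auto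
    qed
    let ?K = "{x \<in> ?V. \<exists>y \<in> ?V. y \<noteq> x \<and> \<not> R x y}"
    \<comment> \<open>If \<open>x\<close> and \<open>y\<close> were adjacent, \<open>co\<close>
      would make \<open>x\<close>, \<open>y\<close>, \<open>x'\<close>, \<open>y'\<close> an induced
      4-cycle in this order.\<close>
    have co_clique: "\<not> R x y" if K: "x \<in> ?K" "y \<in> ?K" and "x \<noteq> y" for x y
    proof
      assume xy: "R x y"
      obtain x' y' where n: "x' \<in> ?V" "y' \<in> ?V" "x' \<noteq> x" "y' \<noteq> y" "\<not> R x x'" "\<not> R y y'"
        using K by blast
      have yx': "R y x'" and xy': "R x y'"
        using co[of x y x'] co[of x y y'] n xy K sym by auto
      then have "x' \<noteq> y'"
        using n by blast
      then have "R x' y'"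
        using co[of x y' x'] n K xy' yx' sym by auto
      then show False
        using no_C4[of x y x' y'] n xy yx' xy' \<open>x' \<noteq> y'\<close> \<open>x \<noteq> y\<close> K sym by auto
    qed
    have "R x y \<longleftrightarrow> x \<noteq> y \<and> \<not> (x \<in> ?K \<and> y \<in> ?K)" if "x \<in> ?V" "y \<in> ?V" for x y
    proof (cases "R x y")
      case True
      then show ?thesis
        using co_clique[of x y] irrefl[of x] by auto
    next
      case False
      then have "\<not> R y x"
        using sym[of x y] by simp
      with False have "x \<in> ?K" "y \<in> ?K" if "x \<noteq> y"
        using that \<open>x \<in> ?V\<close> \<open>y \<in> ?V\<close> by auto
      then show ?thesis
        using False by blast
    qed
    then have "\<forall>x \<in> ?V. \<forall>y \<in> ?V. R x y \<longleftrightarrow> x \<noteq> y \<and> \<not> (x \<in> ?K \<and> y \<in> ?K)"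
      by blast
    moreover have "?K \<subseteq> ?V"
      by blast
    ultimately show ?thesis
      by (intro exI[of _ ?K] conjI disjI2)
  qed
qed

section \<open>Isomorphism with a clique plus isolated vertices\<close>

text \<open>The isomorphism glues an enumeration of \<open>K\<close> by the first
  \<open>card K\<close> numbers to one of the remaining vertices by the numbers that follow.\<close>

lemma clique_plus_isolated_iso:
  fixes H :: "'a pair_pre_digraph"
  assumes fin: "finite (pverts H)" and K: "K \<subseteq> pverts H"
    and arcs: "parcs H = {(x, y). x \<noteq> y \<and> x \<in> K \<and> y \<in> K}"
  shows "digraph_iso (with_proj H)
    (with_proj (clique_plus_isolated (card K) (card (pverts H - K))))"
proof -
  let ?m = "card K" and ?l = "card (pverts H - K)"
  have finK: "finite K"
    using fin K finite_subset by blast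
  obtain f where f: "bij_betw f K {0..<?m}"
    using ex_bij_betw_finite_nat[OF finK] by blast
  obtain g where g: "bij_betw g (pverts H - K) {?m..<?m + ?l}"
    using finite_same_card_bij[of "pverts H - K" "{?m..<?m + ?l}"] fin by auto
  define h where "h x = (if x \<in> K then f x else g x)" for x
  have hK: "bij_betw h K {0..<?m}"
    using f bij_betw_cong[of K h f] by (simp add: h_def)
  have hV: "bij_betw h (pverts H - K) {?m..<?m + ?l}"
    using g bij_betw_cong[of "pverts H - K" h g] by (simp add: h_def)
  have "bij_betw h (K \<union> (pverts H - K)) ({0..<?m} \<union> {?m..<?m + ?l})"
    using hK hV by (rule bij_betw_combine) auto
  moreover have "K \<union> (pverts H - K) = pverts H" "{0..<?m} \<union> {?m..<?m + ?l} = {..<?m + ?l}"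
    using K by auto
  ultimately have h: "bij_betw h (pverts H) {..<?m + ?l}"
    by simp
  have inj: "inj_on h (pverts H)"
    using h bij_betw_imp_inj_on by blast
  have ha: "map_prod h h ` parcs H = {(u, v). u < ?m \<and> v < ?m \<and> u \<noteq> v}"
  proof -
    have "h ` K = {0..<?m}"
      using hK bij_betw_imp_surj_on by blast
    then have "{(u, v). u < ?m \<and> v < ?m \<and> u \<noteq> v} = {(u, v). u \<in> h ` K \<and> v \<in> h ` K \<and> u \<noteq> v}"
      by auto
    also have "\<dots> = map_prod h h ` parcs H"
      using inj_on_subset[OF inj K] by (force simp: arcs inj_on_def)
    finally show ?thesis
      by simp
  qed
  let ?iso = "\<lparr>iso_verts = h, iso_arcs = map_prod h h, iso_head = snd, iso_tail = fst\<rparr>"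
  have "wf_digraph (with_proj H)"
    using K by unfold_locales (auto simp: arcs)
  moreover have "inj_on (map_prod h h) (parcs H)"
    using map_prod_inj_on[OF inj inj] by (rule inj_on_subset) (use K arcs in auto)
  ultimately have "pre_digraph.digraph_isomorphism (with_proj H) ?iso"
    using inj by (simp add: pre_digraph.digraph_isomorphism_def)
  moreover have "with_proj (clique_plus_isolated ?m ?l) = app_iso ?iso (with_proj H)"
    using ha h by (simp add: with_proj_def app_iso_def clique_plus_isolated_def bij_betw_def)
  ultimately show ?thesis
    unfolding digraph_iso_def by blast
qed

text \<open>An edgeless graph is \<open>K\<^sub>1\<close> plus isolated vertices, so \<open>K\<close> may be empty.\<close>

lemma clique_plus_isolated_iso_ex:
  fixes H :: "'a pair_pre_digraph"
  assumes fin: "finite (pverts H)" and ne: "pverts H \<noteq> {}" and K: "K \<subseteq> pverts H"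
    and arcs: "parcs H = {(x, y). x \<noteq> y \<and> x \<in> K \<and> y \<in> K}"
  shows "\<exists>m l. m \<ge> 1 \<and> digraph_iso (with_proj H) (with_proj (clique_plus_isolated m l))"
proof -
  obtain v where v: "v \<in> pverts H"
    using ne by blast
  define K' where "K' = (if K = {} then {v} else K)"
  have "K' \<subseteq> pverts H" "parcs H = {(x, y). x \<noteq> y \<and> x \<in> K' \<and> y \<in> K'}"
    using v K arcs by (auto simp: K'_def)
  then have "digraph_iso (with_proj H)
      (with_proj (clique_plus_isolated (card K') (card (pverts H - K'))))"
    using clique_plus_isolated_iso[OF fin] by blast
  moreover have "card K' \<ge> 1"
    using \<open>K' \<subseteq> pverts H\<close> fin finite_subset card_gt_0_iff[of K']
    by (fastforce simp: K'_def split: if_splits)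
  ultimately show ?thesis
    by blast
qed

lemma digraph_iso_refl:
  assumes "wf_digraph G"
  shows "digraph_iso G G"
  unfolding digraph_iso_def
  using assms
  by (intro exI[of _ "\<lparr>iso_verts = id, iso_arcs = id, iso_head = head G, iso_tail = tail G\<rparr>"])
    (simp add: pre_digraph.digraph_isomorphism_def app_iso_def)

section \<open>From the eigenvalue condition to the switching class\<close>

lemma no_small_inner_triple:
  assumes G: "pair_graph G" and vs: "distinct vs" "set vs = pverts G"
    and few: "size {#x \<in># eigenvalues_mset (seidel_matrix G vs). x \<notin> {-1..1}#} \<le> 2"
    and V: "{a, b, c, d, e} \<subseteq> pverts G" and dist: "distinct [a, b, c, d, e]"
  shows "\<not> small_inner_triple (\<lambda>x y. (x, y) \<in> parcs G) a b c d e"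
proof
  assume indep: "small_inner_triple (\<lambda>x y. (x, y) \<in> parcs G) a b c d e"
  let ?n = "length vs" and ?S = "seidel_matrix G vs"
  note entry = seidel_matrix_index[OF G vs(1)]
  have S: "?S \<in> carrier_mat ?n ?n"
    unfolding seidel_matrix_def adjacency_matrix_def by (intro carrier_matI) simp_all
  have sym: "?S\<^sup>T = ?S"
    using S pair_graph_arcs(2)[OF G] by (intro eq_matI) (auto simp: entry)
  obtain i j k l m where lt: "i < ?n" "j < ?n" "k < ?n" "l < ?n" "m < ?n"
    and nth: "vs ! i = a" "vs ! j = b" "vs ! k = c" "vs ! l = d" "vs ! m = e"
    using V unfolding vs(2)[symmetric] by (auto simp: in_set_conv_nth)
  have dist': "distinct [i, j, k, l, m]"
    using dist nth by auto
  define s :: "bool \<Rightarrow> real" where "s p = (if p then -1 else 1)" for p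
  \<comment> \<open>A product \<open>s p * s p'\<close> is 1 if \<open>p = p'\<close> and -1
    otherwise, so the sum consists of three signs that are not all equal.\<close>
  have bound: "\<bar>s p * s p' + s q * s q' + s r * s r'\<bar> \<le> 1"
    if "not_all_equal (p = p') (q = q') (r = r')" for p p' q q' r r'
    using that by (auto simp: s_def not_all_equal_def)
  have entry': "?S $$ (x, y) = s ((vs ! x, vs ! y) \<in> parcs G)" if "x < ?n" "y < ?n" "x \<noteq> y" for x y
    using that by (simp add: entry s_def)
  have "3 \<le> size {#x \<in># proots (char_poly ?S). x \<notin> {-1..1}#}"
  proof (rule three_large_eigenvalues[OF S sym _ lt dist'])
    show "?S $$ (x, y) \<in> (if x = y then {0} else {-1, 1})" if "x < ?n" "y < ?n" for x y
      using that by (simp add: entry)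
  qed (use indep dist' lt in \<open>auto simp: entry' nth small_inner_triple_def intro!: bound\<close>)
  with few show False
    by (simp add: eigenvalues_mset_def)
qed

theorem theorem3p2:
  fixes G :: "'a pair_pre_digraph" and vs :: "'a list"
  assumes "pair_graph G"
    and "pverts G \<noteq> {}"
    and "distinct vs" and "set vs = pverts G"
    and "size {#x \<in># eigenvalues_mset (seidel_matrix G vs). x \<notin> {-1..1}#} \<le> 2"
  shows "\<exists>H :: 'a pair_pre_digraph. H \<in> family_F \<and> switching_equivalent G H"
proof -
  note arcs = pair_graph_arcs[OF assms(1)]
  have fin: "finite (pverts G)"
    using assms(4) by (metis List.finite_set)
  obtain v where v: "v \<in> pverts G"
    using assms(2) by blast
  \<comment> \<open>Switching the neighbourhood of \<open>v\<close> isolates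
    \<open>v\<close>.\<close>
  define X where "X = {x. (v, x) \<in> parcs G}"
  define R where "R = (\<lambda>x y. (x, y) \<in> parcs (switch G X))"
  have XV: "X \<subseteq> pverts G"
    using arcs(3) by (auto simp: X_def)
  note switched = pair_graph_arcs[OF pair_graph_switch[OF assms(1)]]
  have Rv: "\<not> R v x" for x
    using arcs(1) by (auto simp: R_def parcs_switch X_def)
  have free: "\<not> small_inner_triple R a b c d e"
    if "{a, b, c, d, e} \<subseteq> pverts G" "distinct [a, b, c, d, e]" for a b c d e
    using no_small_inner_triple[OF assms(1,3,4,5) that] small_inner_triple_switch[OF that(1), of X]
    by (simp add: R_def)
  have "R x y \<longleftrightarrow> R y x" "\<not> R x x" for x y
    using switched(1,2) unfolding R_def by blast+
  from clique_or_co_clique[OF this v Rv free] obtain K where K: "K \<subseteq> pverts G - {v}"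
    and cases: "(\<forall>x \<in> pverts G - {v}. \<forall>y \<in> pverts G - {v}. R x y \<longleftrightarrow> x \<noteq> y \<and> x \<in> K \<and> y \<in> K) \<or>
      (\<forall>x \<in> pverts G - {v}. \<forall>y \<in> pverts G - {v}. R x y \<longleftrightarrow> x \<noteq> y \<and> \<not> (x \<in> K \<and> y \<in> K))"
    by blast
  have equiv: "switching_equivalent G (switch G Y)" if "Y \<subseteq> pverts G" for Y
  proof -
    interpret pair_graph "switch G Y"
      using assms(1) by (rule pair_graph_switch)
    show ?thesis
      unfolding switching_equivalent_def
      using that digraph_iso_refl[OF wf_digraph_axioms] by blast
  qed
  show ?thesis
    using cases
  proof
    assume clique: "\<forall>x \<in> pverts G - {v}. \<forall>y \<in> pverts G - {v}. R x y \<longleftrightarrow> x \<noteq> y \<and> x \<in> K \<and> y \<in> K"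
    have "R x y \<longleftrightarrow> x \<noteq> y \<and> x \<in> K \<and> y \<in> K" for x y
      using clique K Rv switched(2,3)[of x y X] Rv[of x] Rv[of y] unfolding R_def pverts_switch by blast
    then have "parcs (switch G X) = {(x, y). x \<noteq> y \<and> x \<in> K \<and> y \<in> K}"
      by (auto simp: R_def)
    then have "switch G X \<in> family_F"
      unfolding family_F_def
      using clique_plus_isolated_iso_ex[of "switch G X" K] fin assms(2) K
        pair_graph_switch[OF assms(1), of X] by auto
    then show ?thesis
      using equiv[OF XV] by blast
  next
    assume co: "\<forall>x \<in> pverts G - {v}. \<forall>y \<in> pverts G - {v}. R x y \<longleftrightarrow> x \<noteq> y \<and> \<not> (x \<in> K \<and> y \<in> K)"
    \<comment> \<open>Adding \<open>v\<close> to the switching set reverses exactly the pairs at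
      \<open>v\<close>, so \<open>v\<close> becomes dominating and is isolated in the complement,
      whose edges then form a clique on \<open>K\<close>.\<close>
    let ?H = "switch G (insert v X)"
    have old: "(x, y) \<in> parcs ?H \<longleftrightarrow> R x y" if "x \<noteq> v" "y \<noteq> v" for x y
      using that by (simp add: R_def parcs_switch)
    have dominating: "(v, x) \<in> parcs ?H \<and> (x, v) \<in> parcs ?H" if "x \<in> pverts G" "x \<noteq> v" for x
      using that v arcs(2)[of x v] by (auto simp: parcs_switch X_def)
    have "x \<in> pverts G \<and> y \<in> pverts G \<and> x \<noteq> y \<and> (x, y) \<notin> parcs ?H \<longleftrightarrow> x \<noteq> y \<and> x \<in> K \<and> y \<in> K" for x y
      using co K old[of x y] dominating[of x] dominating[of y] by blast
    then have "parcs (graph_complement ?H) = {(x, y). x \<noteq> y \<and> x \<in> K \<and> y \<in> K}"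
      by (auto simp: graph_complement_def)
    then have "?H \<in> family_F"
      unfolding family_F_def
      using clique_plus_isolated_iso_ex[of "graph_complement ?H" K] fin assms(2) K
        pair_graph_switch[OF assms(1), of "insert v X"]
      by (auto simp: graph_complement_def)
    moreover have "insert v X \<subseteq> pverts G"
      using XV v by simp
    ultimately show ?thesis
      using equiv by blast
  qed
qed

end
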